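(* Let $2\le k\le n-1$ and let $\lambda\in\partial\Gamma_k(n)=\mathbf{P}_1\cup\mathbf{P}_2$. Then one of the following two cases holds: (I) $\sigma_k(\lambda)=0$ and $\sigma_{k+1}(\lambda)<0$, and in this case $\sigma_{k-1;i}(\lambda)>0$ for all $i=1,2,\dots,n$; or (II) $\sigma_k(\lambda)=0=\sigma_{k+1}(\lambda)$, and in this case $\sigma_j(\lambda)=0$ for $j=k+2,\dots,n$, so that $\lambda\in\overline\Gamma_n(n)$.
   Context: For $\lambda\in\mathbb{R}^n$, $\sigma_j(\lambda)$ is the $j$-th elementary symmetric polynomial, $\sigma_0=1$, and $\sigma_{j;i}(\lambda)=\partial\sigma_{j+1}(\lambda)/\partial\lambda_i$, i.e. $\sigma_j$ evaluated with $\lambda_i$ replaced by $0$. $\Gamma_k(n)=\{\lambda\in\mathbb{R}^n:\sigma_j(\lambda)>0,\ 1\le j\le k\}$, $\overline\Gamma_k(n)=\{\lambda:\sigma_j(\lambda)\ge0,\ 1\le j\le k\}$ is its closure, and its boundary is $\partial\Gamma_k(n)=\{\lambda\in\mathbb{R}^n:\sigma_j(\lambda)\ge0\ (1\le j\le k-1),\ \sigma_k(\lambda)=0\}$. The boundary is split as $\mathbf{P}_1=\{\lambda\in\partial\Gamma_k(n):\sigma_{k+1}(\lambda)=0\}$ and $\mathbf{P}_2=\{\lambda\in\partial\Gamma_k(n):\sigma_{k+1}(\lambda)<0\}$. *)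

theory Defs
  imports "HOL-Analysis.Analysis"
begin

definition esym :: "nat \<Rightarrow> real ^ 'n \<Rightarrow> real" where
  "esym j x = (\<Sum>S | S \<subseteq> (UNIV :: 'n set) \<and> card S = j. \<Prod>i\<in>S. x $ i)"

definition repl :: "real ^ 'n \<Rightarrow> 'n \<Rightarrow> real \<Rightarrow> real ^ 'n" where
  "repl x i t = (\<chi> m. if m = i then t else x $ m)"

(* esym_del j i is sigma_{j;i}, the partial derivative of esym (j + 1) in the i-th variable:
   see has_real_derivative_esym below. *)
definition esym_del :: "nat \<Rightarrow> 'n \<Rightarrow> real ^ 'n \<Rightarrow> real" where
  "esym_del j i x = esym j (repl x i 0)"

(* The closed cone and the boundary of Gamma_k are the explicit sets cut out by the
   (in)equalities on the elementary symmetric polynomials, not topological closure and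
   frontier. The dimension n is CARD('n). *)
definition Gamma_closed :: "nat \<Rightarrow> (real ^ 'n) set" where
  "Gamma_closed k = {x. \<forall>j\<in>{1..k}. esym j x \<ge> 0}"

definition Gamma_boundary :: "nat \<Rightarrow> (real ^ 'n) set" where
  "Gamma_boundary k = {x. (\<forall>j\<in>{1..k - 1}. esym j x \<ge> 0) \<and> esym k x = 0}"

definition P1 :: "nat \<Rightarrow> (real ^ 'n) set" where
  "P1 k = {x \<in> Gamma_boundary k. esym (k + 1) x = 0}"

definition P2 :: "nat \<Rightarrow> (real ^ 'n) set" where
  "P2 k = {x \<in> Gamma_boundary k. esym (k + 1) x < 0}"

lemma esym_0: "esym 0 x = 1"
proof -
  have "{S. S \<subseteq> (UNIV :: 'a set) \<and> card S = 0} = {{}}"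
    by auto
  then show ?thesis
    unfolding esym_def by simp
qed

lemma repl_same [simp]: "repl x i (x $ i) = x"
  by (simp add: repl_def vec_eq_iff)

lemma esym_del_eq:
  "esym_del j i x = (\<Sum>S | i \<notin> S \<and> card S = j. \<Prod>m\<in>S. x $ m)"
proof -
  have "(\<Prod>m\<in>S. repl x i 0 $ m) = (if i \<in> S then 0 else \<Prod>m\<in>S. x $ m)" for S
    by (auto simp: repl_def intro!: prod_zero prod.cong)
  then have "esym_del j i x = (\<Sum>S | card S = j. if i \<in> S then 0 else \<Prod>m\<in>S. x $ m)"
    by (simp add: esym_del_def esym_def)
  also have "\<dots> = (\<Sum>S | i \<notin> S \<and> card S = j. \<Prod>m\<in>S. x $ m)"
    by (rule sum.mono_neutral_cong_right) auto
  finally show ?thesis .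
qed

lemma esym_Suc_repl:
  "esym (Suc j) (repl x i t) = t * esym_del j i x + esym_del (Suc j) i x"
proof -
  let ?f = "\<lambda>S. \<Prod>m\<in>S. repl x i t $ m"
  let ?A = "{S. i \<in> S \<and> card S = Suc j}" and ?B = "{S. i \<notin> S \<and> card S = Suc j}"
  have "esym (Suc j) (repl x i t) = sum ?f (?A \<union> ?B)"
    unfolding esym_def by (rule sum.cong) auto
  also have "\<dots> = sum ?f ?A + sum ?f ?B"
    by (rule sum.union_disjoint) auto
  also have "sum ?f ?A = (\<Sum>S | i \<notin> S \<and> card S = j. t * (\<Prod>m\<in>S. x $ m))"
  proof (rule sum.reindex_bij_witness[where i = "insert i" and j = "\<lambda>S. S - {i}"])
    fix S assume S: "S \<in> ?A"
    have "?f S = repl x i t $ i * (\<Prod>m\<in>S - {i}. repl x i t $ m)"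
      using S by (intro prod.remove) auto
    also have "(\<Prod>m\<in>S - {i}. repl x i t $ m) = (\<Prod>m\<in>S - {i}. x $ m)"
      by (rule prod.cong) (auto simp: repl_def)
    finally show "t * (\<Prod>m\<in>S - {i}. x $ m) = ?f S"
      by (simp add: repl_def)
  qed (auto simp: card_insert_if)
  also have "\<dots> = t * esym_del j i x"
    by (simp add: esym_del_eq sum_distrib_left)
  also have "sum ?f ?B = esym_del (Suc j) i x"
    unfolding esym_del_eq by (intro sum.cong prod.cong) (auto simp: repl_def)
  finally show ?thesis .
qed

lemma has_real_derivative_esym:
  "((\<lambda>t. esym (Suc j) (repl x i t)) has_real_derivative esym_del j i x) (at (x $ i))"
  unfolding esym_Suc_repl by (auto intro!: derivative_eq_intros)

end

theory Submission
  imports Defs "HOL-Computational_Algebra.Fundamental_Theorem_Algebra"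
begin

text \<open>
  The numbers \<open>\<sigma>\<^sub>j\<close> are the coefficients of the real-rooted polynomial
  \<open>\<Prod>\<^sub>i (1 + x\<^sub>i t)\<close>. Derivatives of real-rooted polynomials are real-rooted, so the Laguerre
  inequality \<open>p'\<^sup>2 > p p''\<close> at \<open>0\<close>, applied to the higher derivatives, gives the strict Newton
  inequality \<open>\<sigma>\<^sub>j \<sigma>\<^sub>j\<^sub>+\<^sub>2 < \<sigma>\<^sub>j\<^sub>+\<^sub>1\<^sup>2\<close> unless \<open>\<sigma>\<close> vanishes beyond \<open>j\<close> or \<open>\<sigma>\<^sub>j = 0\<close>. Hence two
  consecutive zeros force all later \<open>\<sigma>\<^sub>l\<close> to vanish, which yields case (II). In case (I) a first
  index \<open>j < k\<close> with \<open>\<sigma>\<^sub>j\<^sub>;\<^sub>i \<le> 0\<close> would, through \<open>\<sigma>\<^sub>j = \<sigma>\<^sub>j\<^sub>;\<^sub>i + x\<^sub>i \<sigma>\<^sub>j\<^sub>-\<^sub>1\<^sub>;\<^sub>i\<close>, contradict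
  the Newton inequality for the remaining variables.
\<close>

section \<open>Real-rooted polynomials\<close>

text \<open>Zeros are sought over the complex numbers, so that the fundamental theorem of algebra
  supplies one for every nonconstant polynomial. Nonzero constants qualify vacuously.\<close>

definition real_rooted :: "real poly \<Rightarrow> bool" where
  "real_rooted p \<longleftrightarrow>
     p \<noteq> 0 \<and> (\<forall>z::complex. poly (map_poly of_real p) z = 0 \<longrightarrow> Im z = 0)"

lemma poly_of_real_mult:
  "poly (map_poly of_real (p * q)) (z::complex) =
     poly (map_poly of_real p) z * poly (map_poly of_real q) z"
proof -
  have "map_poly of_real (p * q) = (map_poly of_real p * map_poly of_real q :: complex poly)"
    by (rule poly_eqI) (simp add: coeff_map_poly coeff_mult)
  then show ?thesis by simp
qed

lemma poly_of_real_pCons: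
  "poly (map_poly of_real (pCons a p)) (z::complex) =
     of_real a + z * poly (map_poly of_real p) z"
  by (simp add: map_poly_pCons)

lemma poly_of_real_add:
  "poly (map_poly of_real (p + q)) (z::complex) =
     poly (map_poly of_real p) z + poly (map_poly of_real q) z"
proof -
  have "map_poly of_real (p + q) = (map_poly of_real p + map_poly of_real q :: complex poly)"
    by (rule poly_eqI) (simp add: coeff_map_poly)
  then show ?thesis by simp
qed

lemma poly_of_real_of_real:
  "poly (map_poly of_real p) (of_real x :: complex) = of_real (poly p x)"
  by (induction p) (simp_all add: map_poly_pCons)

lemma real_rooted_mult:
  "real_rooted p \<Longrightarrow> real_rooted q \<Longrightarrow> real_rooted (p * q)"
  by (auto simp: real_rooted_def poly_of_real_mult)

lemma real_rooted_mult_right: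
  "real_rooted (p * q) \<Longrightarrow> real_rooted q"
  by (auto simp: real_rooted_def poly_of_real_mult)

lemma real_rooted_one: "real_rooted 1"
  by (simp add: real_rooted_def)

lemma real_rooted_linear: "real_rooted [:1, a:]"
  unfolding real_rooted_def
proof (intro conjI allI impI)
  fix z :: complex
  assume "poly (map_poly of_real [:1, a:]) z = 0"
  then have z: "1 + z * of_real a = 0"
    by (simp add: map_poly_pCons)
  then have "Re (1 + z * of_real a) = 0" "Im (1 + z * of_real a) = 0"
    by simp_all
  then show "Im z = 0" by auto
qed simp

lemma real_rooted_prod:
  "(\<And>i. i \<in> A \<Longrightarrow> real_rooted (f i)) \<Longrightarrow> real_rooted (\<Prod>i\<in>A. f i)"
  by (induction A rule: infinite_finite_induct) (auto intro: real_rooted_one real_rooted_mult)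

text \<open>A complex zero exists and must be real, so it splits off a linear factor over the reals.
  The cofactor inherits real-rootedness.\<close>

lemma real_rooted_induct [consumes 1, case_names const linear]:
  assumes "real_rooted p"
    and const: "\<And>c. c \<noteq> 0 \<Longrightarrow> P [:c:]"
    and linear: "\<And>r q. real_rooted q \<Longrightarrow> P q \<Longrightarrow> P ([:- r, 1:] * q)"
  shows "P p"
  using assms(1)
proof (induction "degree p" arbitrary: p)
  case 0
  then obtain c where c: "p = [:c:]"
    by (metis degree_eq_zeroE)
  with 0 have "c \<noteq> 0" by (simp add: real_rooted_def)
  with c show ?case using const by simp
next
  case (Suc d)
  have "degree (map_poly of_real p :: complex poly) = Suc d"
    using Suc by (simp add: degree_map_poly)
  then have "\<exists>z. poly (map_poly of_real p) z = (0::complex)"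
    by (intro fundamental_theorem_of_algebra_alt) auto
  then obtain z :: complex where z: "poly (map_poly of_real p) z = 0" ..
  with Suc.prems have "Im z = 0" by (auto simp: real_rooted_def)
  then have "z = of_real (Re z)" by (simp add: complex_eq_iff)
  with z have "poly p (Re z) = 0"
    by (metis poly_of_real_of_real of_real_eq_0_iff)
  then obtain q where q: "p = [:- Re z, 1:] * q"
    by (auto simp: poly_eq_0_iff_dvd elim: dvdE)
  have rq: "real_rooted q"
    using Suc.prems q real_rooted_mult_right by blast
  then have "q \<noteq> 0" by (simp add: real_rooted_def)
  then have "degree p = Suc (degree q)"
    unfolding q by (subst degree_mult_eq) auto
  with Suc have "P q" using rq by simp
  then show ?case using linear rq q by simp
qed

text \<open>Every term of \<open>p'/p = \<Sum> 1/(z - r)\<close> has imaginary part of sign opposite to \<open>Im z\<close>.\<close>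

lemma real_rooted_log_deriv:
  fixes z :: complex
  assumes "real_rooted p" "Im z \<noteq> 0"
  defines "w \<equiv> poly (map_poly of_real (pderiv p)) z / poly (map_poly of_real p) z"
  shows "Im z * Im w \<le> 0 \<and> (degree p > 0 \<longrightarrow> Im z * Im w < 0)"
  using assms(1) unfolding w_def
proof (induction rule: real_rooted_induct)
  case (const c)
  then show ?case by simp
next
  case (linear r q)
  let ?c = "\<lambda>p. poly (map_poly of_real p) z"
  have q: "?c q \<noteq> 0" using linear(1) assms(2) by (auto simp: real_rooted_def)
  have z: "z - of_real r \<noteq> 0" using assms(2) by auto
  have lin: "?c [:- r, 1:] = z - of_real r" by (simp add: map_poly_pCons)
  have "?c (pderiv ([:- r, 1:] * q)) = (z - of_real r) * ?c (pderiv q) + ?c q"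
    unfolding pderiv_mult poly_of_real_add poly_of_real_mult lin
    by (simp add: pderiv_pCons one_pCons[symmetric])
  then have "?c (pderiv ([:- r, 1:] * q)) / ?c ([:- r, 1:] * q) =
      ?c (pderiv q) / ?c q + 1 / (z - of_real r)"
    unfolding poly_of_real_mult lin using q z by (simp add: field_simps)
  moreover have "Im z * Im (1 / (z - of_real r)) < 0"
  proof -
    have "Im (1 / (z - of_real r)) = - Im z / ((Re z - r)\<^sup>2 + (Im z)\<^sup>2)"
      by (simp add: Im_divide)
    moreover have "(Re z - r)\<^sup>2 + (Im z)\<^sup>2 > 0"
      using assms(2) by (simp add: sum_power2_gt_zero_iff)
    moreover have "Im z * Im z > 0" using assms(2) by (simp add: zero_less_mult_iff) linarith
    ultimately show ?thesis by (simp add: divide_less_0_iff)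
  qed
  ultimately have "Im z * Im (?c (pderiv ([:- r, 1:] * q)) / ?c ([:- r, 1:] * q)) < 0"
    using linear(2) by (simp add: distrib_left)
  then show ?case by simp
qed

text \<open>At a nonreal zero of \<open>pderiv p\<close> the logarithmic derivative would be 0,
  against its strictly signed imaginary part.\<close>

lemma real_rooted_pderiv:
  assumes "real_rooted p" "degree p > 0"
  shows "real_rooted (pderiv p)"
  unfolding real_rooted_def
proof (intro conjI allI impI)
  show "pderiv p \<noteq> 0" using assms(2) by (simp add: pderiv_eq_0_iff)
  fix z :: complex
  assume "poly (map_poly of_real (pderiv p)) z = 0"
  then show "Im z = 0"
    using real_rooted_log_deriv[OF assms(1), of z] assms(2) by auto
qed

lemma real_rooted_higher_pderiv:
  "real_rooted p \<Longrightarrow> m \<le> degree p \<Longrightarrow> real_rooted ((pderiv ^^ m) p)"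
proof (induction m)
  case (Suc m)
  then show ?case
    by (auto intro!: real_rooted_pderiv simp: degree_higher_pderiv)
qed simp

lemma real_rooted_laguerre_0:
  assumes "real_rooted p" "coeff p 0 \<noteq> 0" "degree p > 0"
  shows "2 * coeff p 0 * coeff p 2 < (coeff p 1)\<^sup>2"
proof -
  \<comment> \<open>Constants give only equality, so the induction carries the weak inequality and
    adds strictness for positive degree.\<close>
  have "coeff p 0 \<noteq> 0 \<longrightarrow> 2 * coeff p 0 * coeff p 2 \<le> (coeff p 1)\<^sup>2 \<and>
      (degree p > 0 \<longrightarrow> 2 * coeff p 0 * coeff p 2 < (coeff p 1)\<^sup>2)"
    using assms(1)
  proof (induction rule: real_rooted_induct)
    case (const c)
    then show ?case by (simp add: numeral_2_eq_2)
  next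
    case (linear r q)
    let ?p = "[:- r, 1:] * q"
    have c: "coeff ?p 0 = - r * coeff q 0" "coeff ?p 1 = coeff q 0 - r * coeff q 1"
      "coeff ?p 2 = coeff q 1 - r * coeff q 2"
      by (simp_all add: numeral_2_eq_2)
    \<comment> \<open>With \<open>D\<close> the value of \<open>p'^2 - p p''\<close> at 0, the
      factor \<open>X - r\<close> turns \<open>D\<close> into \<open>q(0)^2 + r^2 D\<close>, which
      is positive once \<open>D\<close> is nonnegative.\<close>
    have eq: "(coeff ?p 1)\<^sup>2 - 2 * coeff ?p 0 * coeff ?p 2 =
        (coeff q 0)\<^sup>2 + r\<^sup>2 * ((coeff q 1)\<^sup>2 - 2 * coeff q 0 * coeff q 2)"
      unfolding c by (simp add: power2_eq_square algebra_simps)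
    show ?case
    proof
      assume "coeff ?p 0 \<noteq> 0"
      then have q0: "coeff q 0 \<noteq> 0" using c(1) by auto
      then have "(coeff q 1)\<^sup>2 - 2 * coeff q 0 * coeff q 2 \<ge> 0"
        using linear(2) by auto
      then have "r\<^sup>2 * ((coeff q 1)\<^sup>2 - 2 * coeff q 0 * coeff q 2) \<ge> 0"
        by simp
      moreover have "(coeff q 0)\<^sup>2 > 0" using q0 by simp
      ultimately have "2 * coeff ?p 0 * coeff ?p 2 < (coeff ?p 1)\<^sup>2"
        using eq by linarith
      then show "2 * coeff ?p 0 * coeff ?p 2 \<le> (coeff ?p 1)\<^sup>2 \<and>
          (degree ?p > 0 \<longrightarrow> 2 * coeff ?p 0 * coeff ?p 2 < (coeff ?p 1)\<^sup>2)"
        by simp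
    qed
  qed
  with assms show ?thesis by simp
qed

lemma real_rooted_newton:
  assumes "real_rooted p" "coeff p m \<noteq> 0" "degree p > m"
  shows "coeff p m * coeff p (m + 2) < (coeff p (m + 1))\<^sup>2"
proof -
  let ?q = "(pderiv ^^ m) p"
  have c0: "coeff ?q 0 = fact m * coeff p m"
    by (simp add: coeff_higher_pderiv pochhammer_fact)
  have c1: "coeff ?q 1 = fact m * real (m + 1) * coeff p (m + 1)"
    using pochhammer_rec[of "1::real" m] pochhammer_rec'[of "1::real" m]
    by (simp add: coeff_higher_pderiv pochhammer_fact algebra_simps)
  \<comment> \<open>The factor 2 clears the denominator of \<open>pochhammer 3 m\<close>, which is
    \<open>(m+2)!/2\<close>.\<close>
  have c2: "2 * coeff ?q 2 = fact m * real (m + 1) * real (m + 2) * coeff p (m + 2)"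
  proof -
    have "2 * pochhammer 3 m = (fact m * real (m + 1) * real (m + 2) :: real)"
      using pochhammer_rec[of "1::real" "m + 1"] pochhammer_rec[of "2::real" m]
        pochhammer_rec'[of "1::real" "m + 1"] pochhammer_rec'[of "1::real" m]
      by (simp add: pochhammer_fact algebra_simps)
    moreover have "coeff ?q 2 = pochhammer 3 m * coeff p (m + 2)"
      by (simp add: coeff_higher_pderiv add.commute)
    ultimately show ?thesis by (metis mult.assoc)
  qed
  have "2 * coeff ?q 0 * coeff ?q 2 < (coeff ?q 1)\<^sup>2"
    using assms by (intro real_rooted_laguerre_0 real_rooted_higher_pderiv)
      (auto simp: c0 degree_higher_pderiv)
  moreover have "2 * coeff ?q 0 * coeff ?q 2 =
      (fact m)\<^sup>2 * real (m + 1) * (real (m + 2) * (coeff p m * coeff p (m + 2)))"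
  proof -
    have "2 * coeff ?q 0 * coeff ?q 2 = coeff ?q 0 * (2 * coeff ?q 2)" by simp
    then show ?thesis unfolding c0 c2 by (simp add: power2_eq_square)
  qed
  moreover have "(coeff ?q 1)\<^sup>2 =
      (fact m)\<^sup>2 * real (m + 1) * (real (m + 1) * (coeff p (m + 1))\<^sup>2)"
    unfolding c1 by (simp add: power2_eq_square algebra_simps)
  ultimately have "(fact m)\<^sup>2 * real (m + 1) * (real (m + 2) * (coeff p m * coeff p (m + 2))) <
      (fact m)\<^sup>2 * real (m + 1) * (real (m + 1) * (coeff p (m + 1))\<^sup>2)"
    by simp
  then have less: "real (m + 2) * (coeff p m * coeff p (m + 2)) <
      real (m + 1) * (coeff p (m + 1))\<^sup>2"
    by (simp add: mult_less_cancel_left_pos del: of_nat_add)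
  \<comment> \<open>The bound just obtained is sharper. If the claim failed, the product would be at
    least a square, hence nonnegative, and the weights \<open>m + 1 < m + 2\<close> would contradict
    \<open>less\<close>.\<close>
  show ?thesis
  proof (rule ccontr)
    assume "\<not> ?thesis"
    then have "(coeff p (m + 1))\<^sup>2 \<le> coeff p m * coeff p (m + 2)" by simp
    then have "real (m + 1) * (coeff p (m + 1))\<^sup>2 \<le> real (m + 2) * (coeff p m * coeff p (m + 2))"
      by (intro mult_mono) (auto intro: order_trans[OF zero_le_power2])
    with less show False by simp
  qed
qed

section \<open>Newton inequalities for elementary symmetric polynomials\<close>

lemma coeff_prod_linear:
  fixes x :: "real ^ 'n"
  shows "coeff (\<Prod>i\<in>UNIV. [:1, x $ i:]) j = esym j x"
proof -
  have lin: "[:1, a:] = monom a 1 + 1" for a :: real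
    by (simp add: monom_altdef one_pCons)
  have mon: "(\<Prod>i\<in>S. monom (x $ i) 1) = monom (\<Prod>i\<in>S. x $ i) (card S)" for S :: "'n set"
    using finite[of S] by (induction S rule: finite_induct) (auto simp: mult_monom)
  have "(\<Prod>i\<in>UNIV. [:1, x $ i:]) = (\<Sum>S\<in>UNIV. monom (\<Prod>i\<in>S. x $ i) (card S))"
    unfolding lin by (subst prod_add) (simp_all add: mon del: One_nat_def)
  then have "coeff (\<Prod>i\<in>UNIV. [:1, x $ i:]) j =
      (\<Sum>S\<in>UNIV. if card S = j then \<Prod>i\<in>S. x $ i else 0)"
    by (simp add: coeff_sum)
  also have "\<dots> = esym j x"
    unfolding esym_def by (subst sum.inter_filter[symmetric]) auto
  finally show ?thesis .
qed

text \<open>The nonzero coefficient at \<open>l\<close> only certifies that the generating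
  polynomial has degree above \<open>m\<close>.\<close>

lemma esym_newton:
  assumes "esym m x \<noteq> 0" "esym l x \<noteq> 0" "m < l"
  shows "esym m x * esym (m + 2) x < (esym (m + 1) x)\<^sup>2"
proof -
  let ?p = "\<Prod>i\<in>UNIV. [:1, x $ i:]"
  have "real_rooted ?p" by (intro real_rooted_prod real_rooted_linear)
  moreover have "degree ?p > m"
    using assms le_degree[of ?p l] by (simp add: coeff_prod_linear)
  ultimately show ?thesis
    using real_rooted_newton[of ?p m] assms(1) by (simp add: coeff_prod_linear)
qed

text \<open>If some later value were nonzero, Newton's inequality would read \<open>0 < 0\<close> at
  the index just below a pair of zeros unless that value vanishes too. The zeros thus descend to
  index 0, where the value is 1.\<close>

lemma esym_consecutive_zeros:
  assumes "esym m x = 0" "esym (m + 1) x = 0" "m \<le> l"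
  shows "esym l x = 0"
proof (rule ccontr)
  assume l: "esym l x \<noteq> 0"
  have "esym j x = 0 \<and> esym (j + 1) x = 0" if "j \<le> m" for j
    using that
  proof (induction rule: inc_induct)
    case base
    then show ?case using assms by simp
  next
    case (step n)
    then show ?case using esym_newton[of n x l] l assms(3) by auto
  qed
  from this[of 0] show False by (simp add: esym_0)
qed

lemma esym_Suc: "esym (Suc j) x = x $ i * esym_del j i x + esym_del (Suc j) i x"
  using esym_Suc_repl[of j x i "x $ i"] by simp

section \<open>The boundary of the cone\<close>

text \<open>This is why \<open>P1\<close> and \<open>P2\<close> exhaust the boundary: with a zero at
  \<open>k\<close>, Newton's inequality gives its two neighbours opposite signs.\<close>

lemma Gamma_boundary_Suc_nonpos:
  assumes "1 \<le> k" "x \<in> Gamma_boundary k"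
  shows "esym (k + 1) x \<le> 0"
proof (rule ccontr)
  assume pos: "\<not> ?thesis"
  obtain m where k: "k = m + 1" using assms(1) by (metis le_add_diff_inverse2)
  have z: "esym (m + 1) x = 0" using assms by (simp add: Gamma_boundary_def k)
  have "esym m x \<ge> 0"
    using assms by (cases m) (auto simp: Gamma_boundary_def k esym_0)
  moreover have "esym m x \<noteq> 0"
    using esym_consecutive_zeros[of m x "k + 1"] z pos k by auto
  ultimately have "esym m x * esym (m + 2) x > 0"
    using pos by (simp add: k)
  moreover have "esym m x * esym (m + 2) x < 0"
    using esym_newton[of m x "k + 1"] \<open>esym m x \<noteq> 0\<close> pos z by (simp add: k)
  ultimately show False by simp
qed

lemma Gamma_boundary_esym_pos:
  assumes "x \<in> Gamma_boundary k" "esym (k + 1) x \<noteq> 0" "j < k"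
  shows "esym j x > 0"
  using assms(3)
proof (induction j)
  case 0
  then show ?case by (simp add: esym_0)
next
  case (Suc j)
  have nonneg: "esym l x \<ge> 0" if "1 \<le> l" "l \<le> k" for l
    using assms(1) that by (cases "l = k") (auto simp: Gamma_boundary_def)
  show ?case
  proof (rule ccontr)
    assume "\<not> ?case"
    then have z: "esym (j + 1) x = 0" using nonneg[of "j + 1"] Suc by simp
    have j: "esym j x > 0" using Suc by simp
    then have "esym j x * esym (j + 2) x < 0"
      using esym_newton[of j x "k + 1"] assms(2) z Suc.prems by simp
    then have "esym (j + 2) x < 0" using j by (simp add: mult_less_0_iff)
    with nonneg[of "j + 2"] Suc.prems show False by simp
  qed
qed

lemma Gamma_boundary_esym_del_pos:
  assumes "x \<in> Gamma_boundary k" "esym (k + 1) x \<noteq> 0" "j < k"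
  shows "esym_del j i x > 0"
  using assms(3)
proof (induction j)
  case 0
  then show ?case by (simp add: esym_del_def esym_0)
next
  case (Suc j)
  let ?s = "\<lambda>j. esym_del j i x" and ?y = "repl x i 0" and ?a = "x $ i"
  have s0: "?s j > 0" using Suc by simp
  have e1: "?a * ?s j + ?s (Suc j) > 0"
    using Gamma_boundary_esym_pos[OF assms(1,2), of "Suc j"] Suc.prems
    by (simp add: esym_Suc[of j x i])
  have "esym (Suc (Suc j)) x \<ge> 0"
    using Suc.prems Gamma_boundary_esym_pos[OF assms(1,2), of "Suc (Suc j)"] assms(1)
    by (cases "Suc (Suc j) = k") (auto simp: Gamma_boundary_def)
  then have e2: "?a * ?s (Suc j) + ?s (Suc (Suc j)) \<ge> 0"
    by (simp add: esym_Suc[of "Suc j" x i])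
  show ?case
  proof (rule ccontr)
    assume "\<not> ?case"
    then have s1: "?s (Suc j) \<le> 0" by simp
    \<comment> \<open>By \<open>e1\<close>, \<open>- ?s (Suc j)\<close> is below
      \<open>?a * ?s j\<close>; both are multiplied by the nonnegative \<open>- ?s (Suc j)\<close>.
      Then \<open>e2\<close> is used, scaled by \<open>?s j\<close>.\<close>
    have "(?s (Suc j))\<^sup>2 \<le> (?a * ?s j) * (- ?s (Suc j))"
      using mult_right_mono[of "- ?s (Suc j)" "?a * ?s j" "- ?s (Suc j)"] s1 e1
      by (simp add: power2_eq_square)
    also have "\<dots> = ?s j * (- (?a * ?s (Suc j)))" by simp
    also have "\<dots> \<le> ?s j * ?s (Suc (Suc j))"
      using s0 e2 by (intro mult_left_mono) auto
    finally have ge: "(?s (Suc j))\<^sup>2 \<le> ?s j * ?s (Suc (Suc j))" .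
    \<comment> \<open>The reversed Newton inequality \<open>ge\<close> is possible for
      \<open>?y\<close> only if everything beyond \<open>j\<close> vanishes; this then kills both
      terms of \<open>esym (k + 1) x\<close>.\<close>
    have tail: "?s l = 0" if "l > j" for l
      using esym_newton[of j ?y l] that s0 ge by (auto simp: esym_del_def)
    have "esym (k + 1) x = 0"
      using esym_Suc[of k x i] tail[of k] tail[of "Suc k"] Suc.prems by simp
    with assms(2) show False by simp
  qed
qed

theorem theorem2p2:
  fixes x :: "real ^ 'n" and k :: nat
  assumes "2 \<le> k" and "k \<le> CARD('n) - 1"
    and "x \<in> Gamma_boundary k"
  shows "(Gamma_boundary k :: (real ^ 'n) set) = P1 k \<union> P2 k \<and>
    ((esym k x = 0 \<and> esym (k + 1) x < 0 \<and>
        (\<forall>i. esym_del (k - 1) i x > 0)) \<or>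
     (esym k x = 0 \<and> esym (k + 1) x = 0 \<and>
        (\<forall>j\<in>{k + 2..CARD('n)}. esym j x = 0) \<and>
        x \<in> Gamma_closed CARD('n)))"
proof (intro conjI)
  show "(Gamma_boundary k :: (real ^ 'n) set) = P1 k \<union> P2 k"
    using Gamma_boundary_Suc_nonpos[of k] assms(1) by (force simp: P1_def P2_def)
next
  have zero: "esym k x = 0" using assms(3) by (simp add: Gamma_boundary_def)
  consider "esym (k + 1) x < 0" | "esym (k + 1) x = 0"
    using Gamma_boundary_Suc_nonpos[of k x] assms by fastforce
  then show "(esym k x = 0 \<and> esym (k + 1) x < 0 \<and>
        (\<forall>i. esym_del (k - 1) i x > 0)) \<or>
     (esym k x = 0 \<and> esym (k + 1) x = 0 \<and>
        (\<forall>j\<in>{k + 2..CARD('n)}. esym j x = 0) \<and>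
        x \<in> Gamma_closed CARD('n))"
  proof cases
    case 1
    then show ?thesis
      using zero Gamma_boundary_esym_del_pos[OF assms(3)] assms(1) by simp
  next
    case 2
    have tail: "esym j x = 0" if "k \<le> j" for j
      using esym_consecutive_zeros[OF zero 2 that] .
    \<comment> \<open>Below \<open>k\<close> the sign comes from the boundary conditions, from
      \<open>k\<close> on from \<open>tail\<close>.\<close>
    have "esym j x \<ge> 0" if "1 \<le> j" for j
      using that tail[of j] assms(3) by (cases "k \<le> j") (auto simp: Gamma_boundary_def)
    then show ?thesis using zero 2 tail by (simp add: Gamma_closed_def)
  qed
qed

end
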